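(* Every 3-edge-connected graph of minimum degree at least three has the strong parity property.
   Context: Graphs are finite and simple. For a graph $G$, $V(G)$ is its vertex set, $d_G(x)$ is the degree of the vertex $x$ in $G$, and $\delta(G)$ is the minimum degree. A graph is 3-edge-connected if it is connected and remains connected after deletion of any set of at most two edges. A spanning subgraph of $G$ is a subgraph with vertex set $V(G)$. A graph $G$ has the strong parity property if for every subset $X\subseteq V(G)$ with $|X|$ even, $G$ has a spanning subgraph $F$ with $\delta(F)\geq 1$ (every vertex has degree at least one in $F$) such that $d_F(v)\equiv 1\pmod 2$ for all $v\in X$ and $d_F(y)\equiv 0\pmod 2$ for all $y\in V(G)\setminus X$. *)

theory Defs
  imports "Graph_Theory.Graph_Theory"
begin

text \<open>
  A finite simple graph is a \<^locale>\<open>pair_graph\<close>: a finite, loopfree, symmetric digraph without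
  parallel arcs. An undirected edge \<open>{u, v}\<close> is represented by the two arcs \<open>(u, v)\<close> and \<open>(v, u)\<close>,
  so the degree of a vertex is its out-degree.
\<close>

definition deg :: "'a pair_pre_digraph \<Rightarrow> 'a \<Rightarrow> nat" where
  "deg G v = out_degree (with_proj G) v"

text \<open>The minimum degree is meaningful only for graphs with at least one vertex.\<close>

definition min_deg :: "'a pair_pre_digraph \<Rightarrow> nat" where
  "min_deg G = Min (deg G ` pverts G)"

definition edges :: "'a pair_pre_digraph \<Rightarrow> 'a set set" where
  "edges G = {{u, v} | u v. (u, v) \<in> parcs G}"

text \<open>Deleting an undirected edge removes both of its arcs and keeps all vertices.\<close>

definition del_edges :: "'a pair_pre_digraph \<Rightarrow> 'a set set \<Rightarrow> 'a pair_pre_digraph" where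
  "del_edges G S = G\<lparr>parcs := {(u, v) \<in> parcs G. {u, v} \<notin> S}\<rparr>"

text \<open>
  The case \<open>S = {}\<close> includes the connectedness of \<open>G\<close> itself (for \<open>k > 0\<close>). Note that
  \<^const>\<open>Digraph_Component.connected\<close> requires a nonempty vertex set.
\<close>

definition edge_connected :: "nat \<Rightarrow> 'a pair_pre_digraph \<Rightarrow> bool" where
  "edge_connected k G \<longleftrightarrow>
     (\<forall>S \<subseteq> edges G. card S < k \<longrightarrow> Digraph_Component.connected (with_proj (del_edges G S)))"

text \<open>
  \<^const>\<open>spanning\<close> alone would allow a subdigraph containing only one of the two arcs of an edge.
\<close>

definition spanning_subgraph :: "'a pair_pre_digraph \<Rightarrow> 'a pair_pre_digraph \<Rightarrow> bool" where
  "spanning_subgraph F G \<longleftrightarrow> pair_graph F \<and> spanning (with_proj F) (with_proj G)"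

definition strong_parity_property :: "'a pair_pre_digraph \<Rightarrow> bool" where
  "strong_parity_property G \<longleftrightarrow>
     (\<forall>X \<subseteq> pverts G. even (card X) \<longrightarrow>
        (\<exists>F. spanning_subgraph F G \<and> min_deg F \<ge> 1 \<and>
             (\<forall>v \<in> X. odd (deg F v)) \<and>
             (\<forall>y \<in> pverts G - X. even (deg F y))))"

lemma deg_eq_card_neighbours: "deg G v = card {w. (v, w) \<in> parcs G}"
proof -
  have "out_arcs (with_proj G) v = Pair v ` {w. (v, w) \<in> parcs G}"
    by auto
  then show ?thesis
    by (simp add: deg_def out_degree_def card_image inj_on_def)
qed

lemma min_deg_ge_iff:
  assumes "finite (pverts G)" "pverts G \<noteq> {}"
  shows "min_deg G \<ge> k \<longleftrightarrow> (\<forall>v \<in> pverts G. deg G v \<ge> k)"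
  using assms by (simp add: min_deg_def)

end

theory Submission
  imports Defs "HOL-Library.Disjoint_Sets"
begin

text \<open>
  The required subgraphs are perfect matchings of an auxiliary graph. Split every edge of \<open>G\<close> into
  two \<^emph>\<open>darts\<close>, one at each end, and join the two darts of an edge (twins). The darts at one vertex
  are pairwise joined as well. Finally each vertex receives extra nodes, joined to its darts but not
  to each other: one if the vertex lies in \<open>X\<close>, two otherwise. In a perfect matching, let \<open>F\<close> consist
  of the edges whose darts are not matched to each other. At a vertex, the darts of \<open>F\<close> and the extra
  nodes are matched among themselves, so the degree in \<open>F\<close> has the parity of the number of extra
  nodes; and it is positive, because an extra node can only be matched to a dart.

  A perfect matching exists by the Tutte--Berge formula (\<open>tutte_berge\<close>), in the following strong
  form: there are a set \<open>S\<close> of nodes and a partition \<open>P\<close> of the remaining nodes into parts of odd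
  size, with no edge between different parts, such that exactly \<open>card P - card S\<close> nodes stay
  unmatched. Since the number of nodes is even, so is this difference, and it suffices to refute
  \<open>card P \<ge> card S + 2\<close>. This is a double count of the pairs of a node of \<open>S\<close> and a part adjacent to it.

  Every node \<open>s \<in> S\<close> is adjacent to at most three parts (\<open>gadget_vertex_bound\<close>). One may contain the
  twin of \<open>s\<close>. The others contain nodes at the vertex of \<open>s\<close>: if a dart remains there, it holds all
  of these together in one part, and if not, there are at most two such nodes, the extra ones.

  Every part is adjacent to at least three nodes of \<open>S\<close> (\<open>gadget_part_bound\<close>). If it contains an extra
  node at a vertex that has lost all its darts to \<open>S\<close>, then these darts do, by the degree condition.
  Otherwise the part consists of all remaining nodes at some set \<open>C\<close> of vertices. As there is another
  part, \<open>C\<close> is not the whole vertex set, so at least three edges leave \<open>C\<close>, and each of them must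
  have a dart in \<open>S\<close>, as its two darts would otherwise connect \<open>C\<close> to a vertex outside.

  The Tutte--Berge formula is proved by deleting a vertex that all maximum matchings cover. When there
  is none, Gallai's lemma (\<open>gallai_exchange\<close>) says that ``no maximum matching misses both of these
  vertices'' is an equivalence relation, and its classes form the partition, with \<open>S = {}\<close>.
\<close>

section \<open>Maximum matchings and the Tutte--Berge formula\<close>

definition matching :: "'v set set \<Rightarrow> 'v set \<Rightarrow> 'v set set \<Rightarrow> bool" where
  "matching E V M \<longleftrightarrow> M \<subseteq> E \<and> \<Union>M \<subseteq> V \<and> disjoint M"

definition max_matching :: "'v set set \<Rightarrow> 'v set \<Rightarrow> 'v set set \<Rightarrow> bool" where
  "max_matching E V M \<longleftrightarrow> matching E V M \<and> (\<forall>N. matching E V N \<longrightarrow> card N \<le> card M)"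

lemma matching_finite: "finite V \<Longrightarrow> matching E V M \<Longrightarrow> finite M"
  by (meson finite_UnionD finite_subset matching_def)

lemma matching_card_le:
  assumes "finite V" "matching E V M"
  shows "card M \<le> card (Pow V)"
  using assms by (intro card_mono) (auto simp: matching_def)

lemma matching_same_edge:
  "matching E V M \<Longrightarrow> e \<in> M \<Longrightarrow> f \<in> M \<Longrightarrow> x \<in> e \<Longrightarrow> x \<in> f \<Longrightarrow> e = f"
  unfolding matching_def disjoint_def by blast

lemma matching_insert:
  assumes "matching E V M" "e \<in> E" "e \<subseteq> V" "e \<inter> \<Union>M = {}"
  shows "matching E V (insert e M)"
  using assms by (auto simp: matching_def pairwise_insert disjnt_def)

lemma matching_subset:
  assumes "matching E V M" "N \<subseteq> M"
  shows "matching E V N"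
  using assms unfolding matching_def by (meson Union_mono order_trans pairwise_subset)

lemma max_matching_exists:
  assumes "finite V"
  shows "\<exists>M. max_matching E V M"
proof -
  have "matching E V {}"
    by (simp add: matching_def)
  moreover have "\<forall>M. matching E V M \<longrightarrow> card M < Suc (card (Pow V))"
    using matching_card_le[OF assms] by (simp add: less_Suc_eq_le)
  ultimately show ?thesis
    unfolding max_matching_def using ex_has_greatest_nat[of "matching E V" "{}" card] by blast
qed

lemma matching_card_Union:
  assumes E: "\<forall>e\<in>E. card e = 2" and M: "matching E V M"
  shows "card (\<Union>M) = 2 * card M"
proof -
  have "card (\<Union>M) = sum card M"
  proof (rule card_Union_disjoint)
    show "disjoint M"
      using M by (simp add: matching_def)
    fix e assume "e \<in> M"
    then have "card e = 2"
      using M E by (auto simp: matching_def)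
    then show "finite e"
      by (intro card_ge_0_finite) simp
  qed
  also have "\<dots> = (\<Sum>e\<in>M. 2)"
    using M E by (intro sum.cong) (auto simp: matching_def)
  finally show ?thesis
    by simp
qed

text \<open>
  A set that no matching edge crosses is paired up by the edges inside it.
\<close>

lemma matching_even_closed:
  assumes E: "\<forall>e\<in>E. card e = 2" and M: "matching E V M"
    and B: "B \<subseteq> \<Union>M" "\<And>e. e \<in> M \<Longrightarrow> e \<inter> B \<noteq> {} \<Longrightarrow> e \<subseteq> B"
  shows "even (card B)"
proof -
  let ?N = "{e \<in> M. e \<subseteq> B}"
  have "matching E V ?N"
    using M by (rule matching_subset) auto
  then have "card (\<Union>?N) = 2 * card ?N"
    by (rule matching_card_Union[OF E])
  moreover have "x \<in> \<Union>?N" if x: "x \<in> B" for x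
  proof -
    obtain e where "e \<in> M" "x \<in> e"
      using B(1) x by blast
    then show ?thesis
      using B(2)[of e] x by blast
  qed
  then have "\<Union>?N = B"
    by auto
  ultimately show ?thesis
    by simp
qed

lemma max_matching_same_card:
  "max_matching E V M \<Longrightarrow> max_matching E V N \<Longrightarrow> card M = card N"
  by (meson le_antisym max_matching_def)

lemma max_matching_covers_edge:
  assumes V: "finite V" and M: "max_matching E V M" and e: "e \<in> E" "e \<subseteq> V"
    and E: "\<forall>e\<in>E. card e = 2"
  shows "e \<inter> \<Union>M \<noteq> {}"
proof
  assume e': "e \<inter> \<Union>M = {}"
  have "e \<noteq> {}"
    using bspec[OF E e(1)] by auto
  then have "e \<notin> M"
    using e' by auto
  moreover have "matching E V (insert e M)"
    using M e e' by (auto simp: max_matching_def intro: matching_insert)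
  moreover have "finite M"
    using V M by (auto simp: max_matching_def intro: matching_finite)
  ultimately show False
    using M unfolding max_matching_def by fastforce
qed

text \<open>
  Gallai's lemma, in contrapositive form: if a maximum matching misses \<open>u\<close> and \<open>v\<close>, then for any
  vertex \<open>t\<close> that can be missed, \<open>t\<close> can be missed together with \<open>u\<close> or \<open>v\<close>. Otherwise choose, among
  the maximum matchings that miss \<open>t\<close>, an \<open>N\<close> that shares as many edges as possible with \<open>M\<close>. As \<open>N\<close>
  covers both \<open>u\<close> and \<open>v\<close>, which \<open>M\<close> misses, and has the same size, \<open>M\<close> covers a vertex \<open>x \<noteq> t\<close>
  that \<open>N\<close> misses. Exchanging an edge of \<open>N\<close> for the edge of \<open>M\<close> at \<open>x\<close> improves the choice of \<open>N\<close>.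
\<close>

lemma gallai_exchange:
  assumes V: "finite V" and E: "\<forall>e\<in>E. card e = 2"
    and M: "max_matching E V M" and uv: "u \<notin> \<Union>M" "v \<notin> \<Union>M" "u \<noteq> v"
    and N0: "max_matching E V N0" "t \<notin> \<Union>N0"
  shows "\<exists>N. max_matching E V N \<and> t \<notin> \<Union>N \<and> (u \<notin> \<Union>N \<or> v \<notin> \<Union>N)"
proof (rule ccontr)
  assume "\<not> ?thesis"
  then have cov: "\<And>N. max_matching E V N \<Longrightarrow> t \<notin> \<Union>N \<Longrightarrow> u \<in> \<Union>N \<and> v \<in> \<Union>N"
    by blast
  have finM: "finite M"
    using V M by (auto simp: max_matching_def intro: matching_finite)
  let ?P = "\<lambda>N. max_matching E V N \<and> t \<notin> \<Union>N"
  have "\<forall>N. ?P N \<longrightarrow> card (M \<inter> N) < Suc (card M)"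
    using finM by (simp add: less_Suc_eq_le card_mono)
  then have "\<exists>N. ?P N \<and> (\<forall>N'. ?P N' \<longrightarrow> card (M \<inter> N') \<le> card (M \<inter> N))"
    using N0 by (intro ex_has_greatest_nat[of ?P N0 _ "Suc (card M)"]) auto
  then obtain N where N: "max_matching E V N" "t \<notin> \<Union>N"
    and best: "\<And>N'. ?P N' \<Longrightarrow> card (M \<inter> N') \<le> card (M \<inter> N)"
    by blast
  have mM: "matching E V M" and mN: "matching E V N"
    using M N by (auto simp: max_matching_def)
  have finN: "finite N"
    using V mN by (rule matching_finite)
  have fin: "finite (\<Union>M)" "finite (\<Union>N)"
    using mM mN V by (auto simp: matching_def intro: finite_subset)
  have "card (\<Union>M) = card (\<Union>N)"
    using matching_card_Union[OF E mM] matching_card_Union[OF E mN] max_matching_same_card[OF M N(1)]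
    by simp
  then have "card (\<Union>M - \<Union>N) = card (\<Union>N - \<Union>M)"
    using fin by (simp add: card_Diff_subset_Int Int_commute)
  moreover have "{u, v} \<subseteq> \<Union>N - \<Union>M"
    using cov[OF N] uv by auto
  then have "card {u, v} \<le> card (\<Union>N - \<Union>M)"
    using fin by (intro card_mono) auto
  \<comment> \<open>Two vertices of \<open>N\<close> that \<open>M\<close> misses are balanced by two of \<open>M\<close> that \<open>N\<close> misses;
    one of the latter differs from \<open>t\<close>.\<close>
  ultimately have "\<not> \<Union>M - \<Union>N \<subseteq> {t}"
    using uv(3) card_mono[of "{t}" "\<Union>M - \<Union>N"] by auto
  then obtain x e where x: "e \<in> M" "x \<in> e" "x \<notin> \<Union>N" "x \<noteq> t"
    by blast
  have eE: "e \<in> E" "e \<subseteq> V"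
    using mM x by (auto simp: matching_def)
  then obtain y where y: "e = {x, y}" "y \<noteq> x"
    using E x(2) by (metis card_2_iff doubleton_eq_iff insertE singletonD)
  have "y \<in> \<Union>N"
    using max_matching_covers_edge[OF V N(1) eE E] x(3) y by auto
  then obtain f where f: "f \<in> N" "y \<in> f"
    by blast
  have fM: "f \<notin> M"
    using matching_same_edge[OF mM x(1), of f y] f y x by auto
  have eN: "e \<notin> N"
    using x by blast
  let ?N = "insert e (N - {f})"
  have "y \<notin> \<Union>(N - {f})"
    using matching_same_edge[OF mN] f by blast
  then have mat: "matching E V ?N"
    using x(3) y eE mN by (intro matching_insert) (auto intro: matching_subset)
  have "card ?N = card N"
    using finN f eN by (metis DiffD1 card.remove card_insert_disjoint finite_Diff)
  then have max: "max_matching E V ?N"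
    using N(1) mat by (simp add: max_matching_def)
  have "t \<notin> \<Union>?N"
    using N(2) x y \<open>y \<in> \<Union>N\<close> by auto
  then have "card (M \<inter> ?N) \<le> card (M \<inter> N)"
    using max best by blast
  moreover have "M \<inter> ?N = insert e (M \<inter> N)"
    using x fM by blast
  ultimately show False
    using finM eN by simp
qed

text \<open>
  The parts need not be connected: they are unions of components of the graph without \<open>S\<close>, and
  working with unions avoids any talk of paths.
\<close>

definition odd_separation :: "'v set set \<Rightarrow> 'v set \<Rightarrow> 'v set \<Rightarrow> 'v set set \<Rightarrow> bool" where
  "odd_separation E V S P \<longleftrightarrow> S \<subseteq> V \<and> partition_on (V - S) P \<and> (\<forall>Q \<in> P. odd (card Q)) \<and>
     (\<forall>e \<in> E. e \<subseteq> V - S \<longrightarrow> (\<exists>Q \<in> P. e \<subseteq> Q))"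

text \<open>
  If every vertex can be missed, the classes of ``not missed together'' are the parts. Two ends of an
  edge are equivalent, since otherwise the edge could be added to a matching missing both. So a
  matching pairs up vertices within classes; one that misses a given vertex covers the rest of its
  class, which makes the class odd. Hence \<open>M\<close>, too, misses a vertex in every class, and by definition
  of the relation it does not miss two.
\<close>

lemma gallai_classes:
  assumes V: "finite V" and E: "\<forall>e\<in>E. card e = 2"
    and miss: "\<And>v. v \<in> V \<Longrightarrow> \<exists>M. max_matching E V M \<and> v \<notin> \<Union>M"
    and M: "max_matching E V M"
  shows "\<exists>P. odd_separation E V {} P \<and> card P + 2 * card M = card V"
proof -
  define r where "r = {(u, v). u \<in> V \<and> v \<in> V \<and>
    (u = v \<or> (\<forall>M. max_matching E V M \<longrightarrow> u \<in> \<Union>M \<or> v \<in> \<Union>M))}"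
  have "trans r"
  proof (rule transI)
    fix u t v
    assume ut: "(u, t) \<in> r" and tv: "(t, v) \<in> r"
    show "(u, v) \<in> r"
    proof (rule ccontr)
      assume "(u, v) \<notin> r"
      then obtain M' where M': "max_matching E V M'" "u \<notin> \<Union>M'" "v \<notin> \<Union>M'" "u \<noteq> v"
        using ut tv by (auto simp: r_def)
      obtain N0 where "max_matching E V N0" "t \<notin> \<Union>N0"
        using miss[of t] ut by (auto simp: r_def)
      then obtain N where "max_matching E V N" "t \<notin> \<Union>N" "u \<notin> \<Union>N \<or> v \<notin> \<Union>N"
        using gallai_exchange[OF V E M'] by blast
      then show False
        using ut tv M' unfolding r_def by blast
    qed
  qed
  then have eq: "equiv V r"
    by (intro equivI refl_onI symI) (auto simp: r_def)
  define P where "P = V // r"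
  have part: "\<Union>P = V" "disjoint P" "{} \<notin> P"
    unfolding P_def disjoint_def
    using Union_quotient[OF eq] quotient_disj[OF eq] in_quotient_imp_non_empty[OF eq] by blast+
  have rel: "(x, y) \<in> r" if "Q \<in> P" "x \<in> Q" "y \<in> Q" for Q x y
    using in_quotient_imp_in_rel[OF eq, of Q x y] that by (simp add: P_def)
  have closed: "y \<in> Q" if "Q \<in> P" "x \<in> Q" "(x, y) \<in> r" for Q x y
    using in_quotient_imp_closed[OF eq, of Q x y] that by (simp add: P_def)
  have edge: "e \<subseteq> Q" if e: "e \<in> E" "e \<subseteq> V" and Q: "Q \<in> P" "e \<inter> Q \<noteq> {}" for e Q
  proof
    fix y assume y: "y \<in> e"
    obtain x where x: "x \<in> e" "x \<in> Q"
      using Q by blast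
    have "x = y \<or> e = {x, y}"
      using bspec[OF E e(1)] x y by (auto simp: card_2_iff)
    moreover have "e \<inter> \<Union>N \<noteq> {}" if "max_matching E V N" for N
      using max_matching_covers_edge[OF V that e E] .
    ultimately have "x = y \<or> (\<forall>N. max_matching E V N \<longrightarrow> x \<in> \<Union>N \<or> y \<in> \<Union>N)"
      by blast
    moreover have "x \<in> V" "y \<in> V"
      using x y e(2) by blast+
    ultimately have "(x, y) \<in> r"
      by (simp add: r_def)
    with closed Q x show "y \<in> Q"
      by blast
  qed
  have odd: "odd (card Q)" if Q: "Q \<in> P" for Q
  proof -
    obtain v where v: "v \<in> Q"
      using Q part by fastforce
    have QV: "Q \<subseteq> V"
      using Q part by blast
    then obtain N where N: "max_matching E V N" "v \<notin> \<Union>N"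
      using miss v by blast
    have cov: "Q - {v} \<subseteq> \<Union>N"
      using rel[OF Q v] N unfolding r_def by blast
    have "even (card (Q - {v}))"
    proof (rule matching_even_closed[OF E])
      show "matching E V N"
        using N by (simp add: max_matching_def)
      fix e assume e: "e \<in> N" "e \<inter> (Q - {v}) \<noteq> {}"
      then have "e \<in> E" "e \<subseteq> V"
        using N by (auto simp: max_matching_def matching_def)
      then show "e \<subseteq> Q - {v}"
        using edge[OF _ _ Q] e N by blast
    qed (use cov in auto)
    moreover have "card Q = Suc (card (Q - {v}))"
      using v QV V by (metis card_Suc_Diff1 finite_subset)
    ultimately show ?thesis
      by simp
  qed
  have mM: "matching E V M"
    using M by (simp add: max_matching_def)
  have one: "\<exists>v. Q - \<Union>M = {v}" if Q: "Q \<in> P" for Q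
  proof -
    have "\<not> Q \<subseteq> \<Union>M"
    proof
      assume "Q \<subseteq> \<Union>M"
      moreover have "e \<subseteq> Q" if "e \<in> M" "e \<inter> Q \<noteq> {}" for e
        using edge[OF _ _ Q that(2)] that(1) mM unfolding matching_def by blast
      ultimately have "even (card Q)"
        by (rule matching_even_closed[OF E mM])
      with odd Q show False
        by blast
    qed
    then obtain v where "v \<in> Q" "v \<notin> \<Union>M"
      by blast
    then show ?thesis
      using rel[OF Q] M unfolding r_def by blast
  qed
  have finQ: "finite Q" if "Q \<in> P" for Q
    using that part(1) V by (auto intro: finite_subset)
  have "finite P"
    using V part(1) by (metis finite_UnionD)
  then have "card (\<Union>Q\<in>P. Q - \<Union>M) = (\<Sum>Q\<in>P. card (Q - \<Union>M))"
    using finQ disjointD[OF part(2)] by (intro card_UN_disjoint) blast+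
  also have "\<dots> = (\<Sum>Q\<in>P. 1)"
    using one by (intro sum.cong) (auto simp: card_1_singleton_iff)
  also have "\<dots> = card P"
    by simp
  finally have "card P = card (\<Union>Q\<in>P. Q - \<Union>M)" ..
  also have "(\<Union>Q\<in>P. Q - \<Union>M) = V - \<Union>M"
    using part(1) by blast
  also have "card (V - \<Union>M) = card V - 2 * card M"
    using matching_card_Union[OF E mM] mM V
    by (metis card_Diff_subset finite_subset matching_def)
  moreover have "2 * card M \<le> card V"
    using matching_card_Union[OF E mM] mM V by (metis matching_def card_mono)
  ultimately have "card P + 2 * card M = card V"
    by simp
  moreover have "odd_separation E V {} P"
    unfolding odd_separation_def partition_on_def
  proof (intro conjI ballI impI)
    fix e assume e: "e \<in> E" "e \<subseteq> V - {}"
    have "e \<noteq> {}"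
      using bspec[OF E e(1)] by auto
    then obtain Q where "Q \<in> P" "e \<inter> Q \<noteq> {}"
      using e part by blast
    then show "\<exists>Q\<in>P. e \<subseteq> Q"
      using edge e by blast
  qed (use part odd in auto)
  ultimately show ?thesis
    by blast
qed

text \<open>
  A vertex \<open>v\<close> that all maximum matchings cover can be moved into \<open>S\<close>: deleting it lowers the matching
  number by exactly one, so the numbers of unmatched vertices on both sides of the equation change
  alike. If there is no such vertex, the classes of Gallai's lemma give a separation with \<open>S = {}\<close>.
\<close>

theorem tutte_berge:
  assumes "finite V" and E: "\<forall>e\<in>E. card e = 2"
  shows "\<exists>M S P. max_matching E V M \<and> odd_separation E V S P \<and>
    card P + 2 * card M = card S + card V"
  using assms(1)
proof (induction V rule: finite_psubset_induct)
  case (psubset V)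
  obtain N where N: "max_matching E V N"
    using max_matching_exists psubset.hyps by blast
  show ?case
  proof (cases "\<forall>v\<in>V. \<exists>M. max_matching E V M \<and> v \<notin> \<Union>M")
    case True
    then obtain P where "odd_separation E V {} P" "card P + 2 * card N = card V"
      using gallai_classes[OF psubset.hyps E _ N] by blast
    then show ?thesis
      using N by fastforce
  next
    case False
    then obtain v where v: "v \<in> V" "\<And>M. max_matching E V M \<Longrightarrow> v \<in> \<Union>M"
      by blast
    then have "V - {v} \<subset> V"
      by blast
    from psubset.IH[OF this] obtain M S P where M: "max_matching E (V - {v}) M"
      and SP: "odd_separation E (V - {v}) S P"
      and card: "card P + 2 * card M = card S + card (V - {v})"
      by blast
    have mN: "matching E V N"
      using N by (simp add: max_matching_def)
    have mM: "matching E V M" and vM: "v \<notin> \<Union>M"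
      using M unfolding max_matching_def matching_def by blast+
    obtain e where e: "e \<in> N" "v \<in> e"
      using v(2)[OF N] by blast
    have "v \<notin> \<Union>(N - {e})"
      using matching_same_edge[OF mN] e by blast
    then have "matching E (V - {v}) (N - {e})"
      using matching_subset[OF mN, of "N - {e}"] unfolding matching_def by blast
    then have "card (N - {e}) \<le> card M"
      using M by (simp add: max_matching_def)
    moreover have "card N = Suc (card (N - {e}))"
      using e matching_finite[OF psubset.hyps mN] by (metis card_Suc_Diff1)
    moreover have "card M < card N"
    proof (rule ccontr)
      assume "\<not> card M < card N"
      then have "max_matching E V M"
        using mM N unfolding max_matching_def by (meson le_trans not_le)
      from v(2)[OF this] vM show False
        by contradiction
    qed
    ultimately have cN: "card N = Suc (card M)"
      by simp
    have S: "S \<subseteq> V - {v}"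
      using SP by (simp add: odd_separation_def)
    then have "finite S" "v \<notin> S"
      using psubset.hyps by (auto intro: finite_subset)
    then have "card (insert v S) = Suc (card S)"
      by simp
    moreover have "card V = Suc (card (V - {v}))"
      using v(1) psubset.hyps by (metis card_Suc_Diff1)
    ultimately have "card P + 2 * card N = card (insert v S) + card V"
      using card cN by simp
    moreover have "V - {v} - S = V - insert v S"
      by blast
    then have "odd_separation E V (insert v S) P"
      using SP v(1) by (auto simp: odd_separation_def)
    ultimately show ?thesis
      using N by blast
  qed
qed

section \<open>Perfect matchings from a count of neighbours\<close>

lemma card_le_if_meets:
  assumes "finite W" "disjoint P" "\<And>Q. Q \<in> P \<Longrightarrow> Q \<inter> W \<noteq> {}"
  shows "card P \<le> card W"
proof -
  define f where "f Q = (SOME x. x \<in> Q \<inter> W)" for Q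
  have f: "f Q \<in> Q \<inter> W" if "Q \<in> P" for Q
    unfolding f_def using assms(3)[OF that] by (metis some_in_eq)
  have "inj_on f P"
  proof (rule inj_onI)
    fix Q Q' assume Q: "Q \<in> P" "Q' \<in> P" "f Q = f Q'"
    then have "f Q \<in> Q \<inter> Q'"
      using f[OF Q(1)] f[OF Q(2)] by simp
    then show "Q = Q'"
      using disjointD[OF assms(2) Q(1,2)] by blast
  qed
  moreover have "f ` P \<subseteq> W"
    using f by auto
  ultimately show ?thesis
    using assms(1) by (rule card_inj_on_le)
qed

text \<open>
  Double counting the adjacent pairs of a vertex of \<open>S\<close> and a part gives \<open>k * card P \<le> k * card S\<close>.
  The first bound is only asked for when there are two parts or more; this suffices because the
  number of unmatched vertices, being even, is at least two if the matching is not perfect.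
\<close>

lemma perfect_matching_if_neighbour_bounds:
  assumes V: "finite V" "even (card V)" and E: "\<forall>e\<in>E. card e = 2" and k: "k > 0"
    and parts: "\<And>S P Q. odd_separation E V S P \<Longrightarrow> 2 \<le> card P \<Longrightarrow> Q \<in> P \<Longrightarrow>
      k \<le> card {s \<in> S. \<exists>q\<in>Q. {s, q} \<in> E}"
    and vertices: "\<And>S P s. odd_separation E V S P \<Longrightarrow> s \<in> S \<Longrightarrow>
      card {Q \<in> P. \<exists>q\<in>Q. {s, q} \<in> E} \<le> k"
  shows "\<exists>M. matching E V M \<and> \<Union>M = V"
proof -
  obtain M S P where M: "max_matching E V M" and SP: "odd_separation E V S P"
    and card: "card P + 2 * card M = card S + card V"
    using tutte_berge[OF V(1) E] by blast
  have mM: "matching E V M"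
    using M by (simp add: max_matching_def)
  have le: "2 * card M \<le> card V"
    using matching_card_Union[OF E mM] mM V by (metis matching_def card_mono)
  have S: "finite S" and P: "finite P"
    using SP V(1) by (auto simp: odd_separation_def intro: finite_subset finite_elements)
  have "card V = 2 * card M"
  proof (rule ccontr)
    assume "card V \<noteq> 2 * card M"
    then have lt: "card S + 2 \<le> card P"
      using card le V(2) by (auto elim!: evenE)
    have "k * card P = (\<Sum>Q\<in>P. k)"
      by simp
    also have "\<dots> \<le> (\<Sum>Q\<in>P. card {s \<in> S. \<exists>q\<in>Q. {s, q} \<in> E})"
      using parts[OF SP] lt by (intro sum_mono) simp
    also have "\<dots> = (\<Sum>s\<in>S. card {Q \<in> P. \<exists>q\<in>Q. {s, q} \<in> E})"
      using P S by (intro sum_multicount_gen) auto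
    also have "\<dots> \<le> (\<Sum>s\<in>S. k)"
      using vertices[OF SP] by (intro sum_mono) simp
    finally have "card P \<le> card S"
      using k by simp
    with lt show False
      by simp
  qed
  then have "\<Union>M = V"
    using matching_card_Union[OF E mM] mM V(1) by (metis card_subset_eq matching_def)
  with mM show ?thesis
    by blast
qed

section \<open>Cuts of an edge-connected graph\<close>

text \<open>
  Otherwise deleting the fewer than \<open>k\<close> edges that leave \<open>C\<close> would make it impossible to reach a
  vertex outside \<open>C\<close> from inside. Each of these edges is counted once, by its arc leaving \<open>C\<close>.
\<close>

lemma edge_connected_cut:
  assumes G: "pair_graph G" and con: "edge_connected k G"
    and C: "C \<subseteq> pverts G" "C \<noteq> {}" "C \<noteq> pverts G"
  shows "k \<le> card {(c, w) \<in> parcs G. c \<in> C \<and> w \<notin> C}"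
proof (rule ccontr)
  interpret pair_graph G by fact
  let ?D = "{(c, w) \<in> parcs G. c \<in> C \<and> w \<notin> C}"
  assume "\<not> k \<le> card ?D"
  define S where "S = (\<lambda>(c, w). {c, w}) ` ?D"
  have "finite ?D"
    using pair_finite_arcs by (rule rev_finite_subset) auto
  then have "card S < k"
    using \<open>\<not> k \<le> card ?D\<close> card_image_le[of ?D "\<lambda>(c, w). {c, w}"] by (simp add: S_def)
  moreover have "S \<subseteq> edges G"
    by (auto simp: S_def edges_def)
  ultimately have "Digraph_Component.connected (with_proj (del_edges G S))"
    using con by (simp add: edge_connected_def)
  then have reach: "\<forall>u\<in>pverts G. \<forall>v\<in>pverts G. u \<rightarrow>\<^sup>*\<^bsub>mk_symmetric (with_proj (del_edges G S))\<^esub> v"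
    by (simp add: connected_def strongly_connected_def del_edges_def)
  obtain c w where c: "c \<in> C" and w: "w \<in> pverts G" "w \<notin> C"
    using C by blast
  let ?H = "with_proj (mk_symmetric (with_proj (del_edges G S)))"
  have step: "y \<in> C" if "(x, y) \<in> arcs_ends ?H" "x \<in> C" for x y
  proof (rule ccontr)
    assume "y \<notin> C"
    moreover have "(x, y) \<in> parcs G" "{x, y} \<notin> S"
      using that pair_sym_arcs
      by (auto simp: parcs_mk_symmetric del_edges_def insert_commute dest: arcs_symmetric)
    ultimately show False
      using that(2) by (auto simp: S_def)
  qed
  have "(c, w) \<in> rtrancl_on (verts ?H) (arcs_ends ?H)"
    using reach c w C(1) by (auto simp: reachable_def)
  then have "w \<in> C"
    by (induction rule: rtrancl_on_induct) (use c step in auto)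
  with w show False
    by simp
qed

section \<open>The gadget graph\<close>

text \<open>
  \<open>Inl (v, w)\<close> is the dart at \<open>v\<close> of the edge between \<open>v\<close> and \<open>w\<close>; \<open>Inr (v, i)\<close> is an extra node at \<open>v\<close>.
\<close>

type_synonym 'a node = "('a \<times> 'a) + ('a \<times> bool)"

fun owner :: "'a node \<Rightarrow> 'a" where
  "owner (Inl (v, w)) = v"
| "owner (Inr (v, i)) = v"

text \<open>
  Extra nodes are their own twins, which adds no edge, as edges join distinct nodes.
\<close>

fun twin :: "'a node \<Rightarrow> 'a node" where
  "twin (Inl (v, w)) = Inl (w, v)"
| "twin (Inr p) = Inr p"

text \<open>
  A vertex of \<open>X\<close> has the one extra node marked \<open>True\<close>; the others have two.
\<close>

definition gadget_verts :: "'a pair_pre_digraph \<Rightarrow> 'a set \<Rightarrow> 'a node set" where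
  "gadget_verts G X = Inl ` parcs G \<union> Inr ` {(v, i). v \<in> pverts G \<and> (v \<in> X \<longrightarrow> i)}"

text \<open>
  The condition \<open>isl x \<or> isl y\<close> keeps the two extra nodes of a vertex apart. They would otherwise be
  matched to each other, and the vertex could be isolated in the subgraph.
\<close>

definition gadget_edges :: "'a node set set" where
  "gadget_edges = {{x, y} | x y. x \<noteq> y \<and>
     (y = twin x \<or> owner x = owner y \<and> (isl x \<or> isl y))}"

lemma twin_twin [simp]: "twin (twin x) = x"
  by (cases x rule: twin.cases) auto

lemma gadget_edges_iff:
  "{x, y} \<in> gadget_edges \<longleftrightarrow> x \<noteq> y \<and> (y = twin x \<or> owner x = owner y \<and> (isl x \<or> isl y))"
  unfolding gadget_edges_def by (auto simp: doubleton_eq_iff)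

lemma gadget_edges_card: "\<forall>e\<in>gadget_edges. card e = 2"
  by (auto simp: gadget_edges_def)

lemma gadget_edge_other_end:
  assumes "e \<in> gadget_edges" "x \<in> e"
  obtains y where "e = {x, y}" "x \<noteq> y"
proof -
  obtain a b where "e = {a, b}" "a \<noteq> b"
    using assms(1) by (auto simp: gadget_edges_def)
  then show thesis
    using that[of a] that[of b] assms(2) by auto
qed

context
  fixes G :: "'a pair_pre_digraph" and X :: "'a set"
  assumes G: "pair_graph G"
begin

interpretation pair_graph G by (rule G)

lemma gadget_finite: "finite (gadget_verts G X)"
proof -
  have "finite {(v, i). v \<in> pverts G \<and> (v \<in> X \<longrightarrow> i)}"
    by (rule finite_subset[of _ "pverts G \<times> UNIV"]) (use pair_finite_verts in auto)
  then show ?thesis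
    using pair_finite_arcs by (simp add: gadget_verts_def)
qed

lemma owner_gadget: "x \<in> gadget_verts G X \<Longrightarrow> owner x \<in> pverts G"
  by (cases x rule: twin.cases) (auto simp: gadget_verts_def dest: wellformed')

text \<open>
  Darts come in pairs of twins, and a vertex has an odd number of extra nodes only if it is in \<open>X\<close>.
\<close>

lemma gadget_even:
  assumes X: "X \<subseteq> pverts G" "even (card X)"
  shows "even (card (gadget_verts G X))"
proof -
  let ?m = "(\<lambda>(v, w). {(v, w), (w, v)}) ` parcs G"
  have "even (card (\<Union>?m))"
  proof (rule matching_even_closed[where E = ?m and M = ?m and V = "parcs G"])
    show "\<forall>e\<in>?m. card e = 2"
      using pair_no_loops by fastforce
    show "matching ?m (parcs G) ?m"
      by (auto simp: matching_def disjoint_def dest: arcs_symmetric)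
  qed auto
  moreover have "\<Union>?m = parcs G"
    by (auto dest: arcs_symmetric)
  ultimately have arcs: "even (card (parcs G))"
    by simp
  have "{(v, i). v \<in> pverts G \<and> (v \<in> X \<longrightarrow> i)}
      = (\<lambda>v. (v, True)) ` pverts G \<union> (\<lambda>v. (v, False)) ` (pverts G - X)"
    by (auto simp: image_iff)
  moreover have "card \<dots> = card (pverts G) + card (pverts G - X)"
    using pair_finite_verts by (subst card_Un_disjoint) (auto simp: card_image inj_on_def)
  moreover have "card (pverts G) = card (pverts G - X) + card X"
    using X pair_finite_verts by (metis card_Diff_subset card_mono finite_subset le_add_diff_inverse2)
  ultimately have "even (card {(v, i). v \<in> pverts G \<and> (v \<in> X \<longrightarrow> i)})"
    using X by simp
  moreover have "card (gadget_verts G X)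
      = card (parcs G) + card {(v, i). v \<in> pverts G \<and> (v \<in> X \<longrightarrow> i)}"
    unfolding gadget_verts_def
    using gadget_finite pair_finite_arcs
    by (subst card_Un_disjoint) (auto simp: card_image gadget_verts_def)
  ultimately show ?thesis
    using arcs by simp
qed

text \<open>
  Parts are closed under adjacency; allowing \<open>x = y\<close> saves a case distinction at every use.
\<close>

lemma odd_separation_adjacent:
  assumes SP: "odd_separation gadget_edges (gadget_verts G X) S P"
    and Q: "Q \<in> P" "x \<in> Q" and y: "y \<in> gadget_verts G X - S"
    and adj: "x = y \<or> {x, y} \<in> gadget_edges"
  shows "y \<in> Q"
proof (cases "x = y")
  case False
  have part: "\<Union>P = gadget_verts G X - S" "disjoint P"
    using SP by (auto simp: odd_separation_def partition_on_def)
  then have "{x, y} \<subseteq> gadget_verts G X - S"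
    using Q y by blast
  then obtain Q' where "Q' \<in> P" "{x, y} \<subseteq> Q'"
    using SP adj False unfolding odd_separation_def by blast
  then show ?thesis
    using disjointD[OF part(2), of Q Q'] Q by blast
qed (use Q in simp)

text \<open>
  In each case at most three nodes are exhibited such that every part adjacent to \<open>s\<close> contains one of them:
  the twin of \<open>s\<close>, and either a remaining dart at the vertex of \<open>s\<close>, which is adjacent to all other
  nodes there, or, when no dart remains, the two extra nodes.
\<close>

lemma gadget_vertex_bound:
  assumes SP: "odd_separation gadget_edges (gadget_verts G X) S P"
  shows "card {Q \<in> P. \<exists>q\<in>Q. {s, q} \<in> gadget_edges} \<le> 3"
proof -
  let ?P = "{Q \<in> P. \<exists>q\<in>Q. {s, q} \<in> gadget_edges}"
  have part: "\<Union>P = gadget_verts G X - S" "disjoint P"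
    using SP by (auto simp: odd_separation_def partition_on_def)
  define v where "v = owner s"
  have "\<exists>W. finite W \<and> card W \<le> 3 \<and> (\<forall>Q\<in>?P. Q \<inter> W \<noteq> {})"
  proof (cases "\<exists>w. Inl (v, w) \<in> gadget_verts G X - S")
    case True
    then obtain w where w: "Inl (v, w) \<in> gadget_verts G X - S"
      by blast
    have "Q \<inter> {twin s, Inl (v, w)} \<noteq> {}" if mem: "Q \<in> ?P" for Q
    proof -
      obtain q where q: "Q \<in> P" "q \<in> Q" "{s, q} \<in> gadget_edges"
        using mem by blast
      show ?thesis
      proof (cases "q = twin s")
        case False
        then have "owner q = v"
          using q(3) by (auto simp: gadget_edges_iff v_def)
        then have "q = Inl (v, w) \<or> {q, Inl (v, w)} \<in> gadget_edges"
          by (auto simp: gadget_edges_iff)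
        then show ?thesis
          using odd_separation_adjacent[OF SP q(1,2) w] by blast
      qed (use q in auto)
    qed
    moreover have "card {twin s, Inl (v, w)} \<le> 3"
      by (simp add: card_insert_if)
    ultimately show ?thesis
      by (intro exI[of _ "{twin s, Inl (v, w)}"]) auto
  next
    case False
    let ?W = "{twin s, Inr (v, True), Inr (v, False)}"
    have "Q \<inter> ?W \<noteq> {}" if mem: "Q \<in> ?P" for Q
    proof -
      obtain q where q: "Q \<in> P" "q \<in> Q" "{s, q} \<in> gadget_edges"
        using mem by blast
      then have "q \<in> gadget_verts G X - S"
        using part by blast
      then have "q \<in> ?W"
        using q(3) False by (cases q rule: owner.cases) (auto simp: gadget_edges_iff v_def)
      with q show ?thesis
        by blast
    qed
    moreover have "card ?W \<le> 3"
      by (simp add: card_insert_if)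
    ultimately show ?thesis
      by (intro exI[of _ ?W]) auto
  qed
  then obtain W where "finite W" "card W \<le> 3" "\<forall>Q\<in>?P. Q \<inter> W \<noteq> {}"
    by blast
  moreover have "disjoint ?P"
    using part(2) by (rule pairwise_subset) auto
  ultimately show ?thesis
    using card_le_if_meets[of W ?P] by fastforce
qed

text \<open>
  Either the part contains an extra node all of whose neighbours lie in \<open>S\<close>, and the degree condition
  applies, or the vertices that own its nodes form a proper subset of the vertices of \<open>G\<close>, and the
  edges of the cut around it contribute one dart in \<open>S\<close> each.
\<close>

lemma gadget_part_bound:
  assumes con: "edge_connected 3 G" and deg: "\<And>v. v \<in> pverts G \<Longrightarrow> 3 \<le> deg G v"
    and SP: "odd_separation gadget_edges (gadget_verts G X) S P"
    and P: "2 \<le> card P" and Q: "Q \<in> P"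
  shows "3 \<le> card {s \<in> S. \<exists>q\<in>Q. {s, q} \<in> gadget_edges}"
proof -
  let ?N = "{s \<in> S. \<exists>q\<in>Q. {s, q} \<in> gadget_edges}"
  let ?V = "gadget_verts G X"
  have part: "\<Union>P = ?V - S" "disjoint P" "{} \<notin> P" and SV: "S \<subseteq> ?V"
    using SP by (auto simp: odd_separation_def partition_on_def)
  have finN: "finite ?N"
    using SV gadget_finite by (auto intro: finite_subset)
  have QV: "Q \<subseteq> ?V - S"
    using Q part by blast
  note near = odd_separation_adjacent[OF SP]
  show ?thesis
  proof (cases "\<exists>q\<in>Q. \<forall>w. Inl (owner q, w) \<in> ?V \<longrightarrow> Inl (owner q, w) \<in> S")
    case True
    then obtain q where q: "q \<in> Q" "\<And>w. Inl (owner q, w) \<in> ?V \<Longrightarrow> Inl (owner q, w) \<in> S"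
      by blast
    define v where "v = owner q"
    have qV: "q \<in> ?V - S"
      using q QV by blast
    let ?D = "Inl ` Pair v ` {w. (v, w) \<in> parcs G} :: 'a node set"
    have "?D \<subseteq> ?N"
    proof
      fix s assume "s \<in> ?D"
      then obtain w where s: "s = Inl (v, w)" "(v, w) \<in> parcs G"
        by blast
      then have "s \<in> ?V"
        by (simp add: gadget_verts_def)
      then have "s \<in> S"
        using q(2) s by (simp add: v_def)
      moreover have "{s, q} \<in> gadget_edges"
        using s \<open>s \<in> S\<close> qV by (auto simp: gadget_edges_iff v_def)
      ultimately show "s \<in> ?N"
        using q by blast
    qed
    then have "card ?D \<le> card ?N"
      using finN by (intro card_mono)
    moreover have "card ?D = deg G v"
      by (simp add: deg_eq_card_neighbours card_image inj_on_def)
    moreover have "3 \<le> deg G v"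
      using deg owner_gadget qV by (simp add: v_def)
    ultimately show ?thesis
      by simp
  next
    case False
    define C where "C = {v. \<exists>w. Inl (v, w) \<in> Q}"
    \<comment> \<open>The remaining nodes at a vertex lie either all in \<open>Q\<close> or all outside \<open>Q\<close>.\<close>
    have owner_C: "owner q \<in> C" if q: "q \<in> Q" for q
    proof -
      obtain w where w: "Inl (owner q, w) \<in> ?V - S"
        using False q by blast
      then have "Inl (owner q, w) \<in> Q"
        by (rule near[OF Q q]) (auto simp: gadget_edges_iff)
      then show ?thesis
        by (auto simp: C_def)
    qed
    have dart_Q: "x \<in> Q" if x: "x \<in> ?V - S" "owner x \<in> C" for x
    proof -
      obtain w where w: "Inl (owner x, w) \<in> Q"
        using x by (auto simp: C_def)
      show ?thesis
        by (rule near[OF Q w x(1)]) (auto simp: gadget_edges_iff)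
    qed
    obtain q where q: "q \<in> Q"
      using Q part by fastforce
    have "P \<noteq> {Q}"
      using P by auto
    then obtain Q' where Q': "Q' \<in> P" "Q' \<noteq> Q"
      using Q by blast
    then obtain q' where q': "q' \<in> Q'"
      using part by fastforce
    have "q' \<notin> Q" "q' \<in> ?V - S"
      using Q' q' Q part disjointD[OF part(2)] by blast+
    then have "owner q' \<notin> C" "owner q' \<in> pverts G"
      using dart_Q owner_gadget by blast+
    moreover have "C \<subseteq> pverts G"
      using QV owner_gadget by (fastforce simp: C_def)
    moreover have "C \<noteq> {}"
      using owner_C q by blast
    ultimately have cut: "3 \<le> card {(c, w) \<in> parcs G. c \<in> C \<and> w \<notin> C}" (is "_ \<le> card ?D")
      using edge_connected_cut[OF G con] by blast
    \<comment> \<open>Each edge of the cut is charged to one of its darts in \<open>S\<close>. As the edge is listed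
      only in the direction leaving \<open>C\<close>, this dart determines it.\<close>
    let ?f = "\<lambda>(c, w). if Inl (c, w) \<in> S then Inl (c, w) else (Inl (w, c) :: 'a node)"
    have "inj_on ?f ?D"
      by (auto simp: inj_on_def split: if_splits)
    moreover have "?f ` ?D \<subseteq> ?N"
    proof
      fix s assume "s \<in> ?f ` ?D"
      then obtain c w where s: "s = ?f (c, w)"
        and cw: "(c, w) \<in> parcs G" "c \<in> C" "w \<notin> C"
        by blast
      have V: "Inl (c, w) \<in> ?V" "Inl (w, c) \<in> ?V"
        using cw arcs_symmetric by (auto simp: gadget_verts_def)
      have "s \<in> S \<and> (\<exists>q\<in>Q. {s, q} \<in> gadget_edges)"
      proof (cases "Inl (c, w) \<in> S")
        case True
        obtain w' where w': "Inl (c, w') \<in> Q"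
          using cw by (auto simp: C_def)
        then have "Inl (c, w) \<noteq> (Inl (c, w') :: 'a node)"
          using True QV by auto
        then have "{Inl (c, w), Inl (c, w')} \<in> gadget_edges"
          by (simp add: gadget_edges_iff)
        with True w' show ?thesis
          by (auto simp: s)
      next
        case False
        have cwQ: "Inl (c, w) \<in> Q"
          using dart_Q V False cw by simp
        have "Inl (w, c) \<notin> Q"
          using cw by (auto simp: C_def)
        have "c \<noteq> w"
          using cw by auto
        then have adj: "{Inl (c, w), Inl (w, c)} \<in> gadget_edges"
          by (simp add: gadget_edges_iff)
        then have "Inl (w, c) \<in> S"
          using near[OF Q cwQ] V \<open>Inl (w, c) \<notin> Q\<close> by blast
        then show ?thesis
          using False cwQ adj by (auto simp: s insert_commute)
      qed
      then show "s \<in> ?N"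
        by simp
    qed
    ultimately have "card ?D \<le> card ?N"
      using finN by (rule card_inj_on_le)
    with cut show ?thesis
      by simp
  qed
qed

text \<open>
  The set \<open>D \<union> R\<close> of the darts of \<open>F\<close> and the extra nodes at \<open>v\<close> is closed under taking partners in the
  matching: darts of \<open>F\<close> are not matched to their twins, so partners stay at \<open>v\<close>, and a dart outside
  \<open>F\<close> has its twin as partner. So \<open>D \<union> R\<close> is even, which fixes the parity of the degree, and the
  partner of an extra node is a dart in \<open>D\<close>.
\<close>

lemma parity_subgraph_if_perfect_matching:
  assumes M: "matching gadget_edges (gadget_verts G X) M" "\<Union>M = gadget_verts G X"
  defines "F \<equiv> G\<lparr>parcs := {(u, v) \<in> parcs G. {Inl (u, v), Inl (v, u)} \<notin> M}\<rparr>"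
  shows "spanning_subgraph F G"
    and "v \<in> pverts G \<Longrightarrow> 1 \<le> deg F v"
    and "v \<in> pverts G \<Longrightarrow> odd (deg F v) \<longleftrightarrow> v \<in> X"
proof -
  have F: "pair_graph F"
  proof (unfold_locales, goal_cases)
    case 3 then show ?case by (simp add: F_def pair_finite_verts)
  next
    case 4 then show ?case
      by (rule finite_subset[OF _ pair_finite_arcs]) (auto simp: F_def)
  next
    case 6 then show ?case
      by (auto simp: F_def symmetric_def insert_commute intro!: symI dest: arcs_symmetric)
  qed (auto simp: F_def dest: wellformed' pair_no_loops)
  have "wf_digraph (with_proj F)"
    using F by (simp add: wf_digraph_wp_iff pair_graph_def pair_digraph_def pair_fin_digraph_def)
  moreover have "wf_digraph (with_proj G)"
    using G by (simp add: wf_digraph_wp_iff pair_graph_def pair_digraph_def pair_fin_digraph_def)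
  ultimately show "spanning_subgraph F G"
    using F unfolding spanning_subgraph_def spanning_def subgraph_def compatible_def
    by (auto simp: F_def)
  assume v: "v \<in> pverts G"
  define D where "D = (Inl ` Pair v ` {w. (v, w) \<in> parcs F} :: 'a node set)"
  define R where "R = (Inr ` Pair v ` {i. v \<in> X \<longrightarrow> i} :: 'a node set)"
  have "finite {w. (v, w) \<in> parcs F}"
    by (rule finite_subset[of _ "pverts G"]) (auto simp: F_def pair_finite_verts dest: wellformed')
  then have D: "finite D" "card D = deg F v"
    by (simp_all add: D_def deg_eq_card_neighbours card_image inj_on_def)
  have closed: "e \<subseteq> D \<union> R" if e: "e \<in> M" "e \<inter> (D \<union> R) \<noteq> {}" for e
  proof -
    obtain x where x: "x \<in> e" "x \<in> D \<union> R"
      using e by blast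
    have "e \<in> gadget_edges"
      using M e by (auto simp: matching_def)
    then obtain y where y: "e = {x, y}" "x \<noteq> y"
      using x(1) by (rule gadget_edge_other_end)
    with \<open>e \<in> gadget_edges\<close> have adj: "y = twin x \<or> owner x = owner y \<and> (isl x \<or> isl y)"
      by (simp add: gadget_edges_iff)
    \<comment> \<open>If \<open>x\<close> is a dart, its edge is in \<open>F\<close>, so its twin is not its partner; an extra node is its
      own twin.\<close>
    have "y \<noteq> twin x"
      using x y e by (auto simp: D_def R_def F_def)
    then have own: "owner y = v"
      using adj x by (auto simp: D_def R_def)
    have "y \<in> gadget_verts G X"
      using M(2) e y by blast
    moreover have "{Inl (v, w), Inl (w, v)} \<notin> M" if "y = Inl (v, w)" for w
    proof
      assume m: "{Inl (v, w), Inl (w, v)} \<in> M"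
      have "e = {Inl (v, w), Inl (w, v)}"
        by (rule matching_same_edge[OF M(1) e(1) m, of y]) (use y that in auto)
      then have "twin x = y"
        using y that by (auto simp: doubleton_eq_iff)
      with \<open>y \<noteq> twin x\<close> show False
        by simp
    qed
    ultimately have "y \<in> D \<union> R"
      using own by (cases y rule: owner.cases) (auto simp: gadget_verts_def D_def R_def F_def)
    with x y show ?thesis
      by blast
  qed
  have sub: "D \<union> R \<subseteq> \<Union>M"
    using v unfolding M(2) by (auto simp: D_def R_def F_def gadget_verts_def)
  have "even (card (D \<union> R))"
    by (rule matching_even_closed[OF gadget_edges_card M(1) sub closed])
  moreover have "card (D \<union> R) = card D + card R"
    using D(1) by (intro card_Un_disjoint) (auto simp: D_def R_def)
  moreover have "card R = (if v \<in> X then 1 else 2)"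
  proof -
    have "{i. v \<in> X \<longrightarrow> i} = (if v \<in> X then {True} else {True, False})"
      by auto
    then have "R = (if v \<in> X then {Inr (v, True)} else {Inr (v, True), Inr (v, False)})"
      by (simp add: R_def)
    then show ?thesis
      by simp
  qed
  ultimately show "odd (deg F v) \<longleftrightarrow> v \<in> X"
    using D(2) by (simp split: if_splits)
  have r: "Inr (v, True) \<in> R"
    by (simp add: R_def)
  then obtain e where e: "e \<in> M" "Inr (v, True) \<in> e"
    using sub by blast
  have "e \<in> gadget_edges"
    using M e by (auto simp: matching_def)
  moreover from this obtain y where y: "e = {Inr (v, True), y}" "Inr (v, True) \<noteq> y"
    using e(2) by (rule gadget_edge_other_end)
  ultimately have "isl y"
    by (auto simp: gadget_edges_iff)
  moreover have "y \<in> D \<union> R"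
    using closed[OF e(1)] e(2) r y(1) by fast
  ultimately have "D \<noteq> {}"
    by (auto simp: R_def)
  then show "1 \<le> deg F v"
    using D by (metis One_nat_def Suc_leI card_gt_0_iff)
qed

end

theorem theorem3:
  fixes G :: "'a pair_pre_digraph"
  assumes "pair_graph G"
    and "edge_connected 3 G"
    and "min_deg G \<ge> 3"
  shows "strong_parity_property G"
proof -
  interpret pair_graph G
    by fact
  have "Digraph_Component.connected (with_proj (del_edges G {}))"
    using assms(2) unfolding edge_connected_def by simp
  then have "pverts G \<noteq> {}"
    by (simp add: connected_def strongly_connected_def del_edges_def)
  then have deg: "3 \<le> deg G v" if "v \<in> pverts G" for v
    using assms(3) that min_deg_ge_iff[OF pair_finite_verts] by blast
  show ?thesis
    unfolding strong_parity_property_def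
  proof (intro allI impI)
    fix X assume X: "X \<subseteq> pverts G" "even (card X)"
    have "\<exists>M. matching gadget_edges (gadget_verts G X) M \<and> \<Union>M = gadget_verts G X"
    proof (rule perfect_matching_if_neighbour_bounds[where k = 3])
      show "finite (gadget_verts G X)"
        by (rule gadget_finite[OF assms(1)])
      show "even (card (gadget_verts G X))"
        by (rule gadget_even[OF assms(1) X])
      show "\<forall>e\<in>gadget_edges. card e = 2"
        by (rule gadget_edges_card)
    next
      fix S P Q
      assume "odd_separation gadget_edges (gadget_verts G X) S P" "2 \<le> card P" "Q \<in> P"
      then show "3 \<le> card {s \<in> S. \<exists>q\<in>Q. {s, q} \<in> gadget_edges}"
        using gadget_part_bound[OF assms(1,2) deg] by blast
    next
      fix S P s
      assume "odd_separation gadget_edges (gadget_verts G X) S P"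
      then show "card {Q \<in> P. \<exists>q\<in>Q. {s, q} \<in> gadget_edges} \<le> 3"
        by (rule gadget_vertex_bound[OF assms(1)])
    qed simp
    then obtain M where M: "matching gadget_edges (gadget_verts G X) M" "\<Union>M = gadget_verts G X"
      by blast
    define F where "F = G\<lparr>parcs := {(u, v) \<in> parcs G. {Inl (u, v), Inl (v, u)} \<notin> M}\<rparr>"
    note F = parity_subgraph_if_perfect_matching[OF assms(1) M, folded F_def]
    have "pverts F = pverts G"
      by (simp add: F_def)
    then have "1 \<le> min_deg F"
      using F(2) \<open>pverts G \<noteq> {}\<close> pair_finite_verts by (simp add: min_deg_ge_iff)
    then show "\<exists>F. spanning_subgraph F G \<and> 1 \<le> min_deg F \<and> (\<forall>v\<in>X. odd (deg F v)) \<and>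
        (\<forall>y\<in>pverts G - X. even (deg F y))"
      using F X(1) by blast
  qed
qed

end
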